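(* (Blame-Subtyping Theorem for $\lambda\mathsf{C}'$.) Let $M:\Gamma\vdash' A$ be a term of $\lambda\mathsf{C}'$ and $\ell$ a blame label. If $M$ is safe for $\ell$, then it is not the case that $M\longrightarrow^{*}\mathtt{blame}\,\ell$.
   Context: **Types.** Base types $b$: $\mathtt{Nat},\mathtt{Bool},\mathtt{Int},\mathtt{Unit},\bot$. Types: $A,B::=b\mid\,?\mid A\to B\mid A\times B\mid A+B$; atomic types $a::=b\mid\,?$; ground types $G,H::=b\mid\,?\to?\mid\,?\times?\mid\,?+?$. Contexts are finite sequences of types; variables are de Bruijn indices (index $0$ is the last-added type). Primitive types $P::=b\mid b\to P$; each $b$ denotes a set (naturals, Booleans, integers, one-element set, empty set), $[\![b\to P]\!]$ is the set of functions $[\![b]\!]\to[\![P]\!]$. Blame labels range over a fixed set. **Casts** are coercions $c,d:A\Rightarrow B$: $\mathsf{id}:a\Rightarrow a$; $G!:G\Rightarrow\,?$; $H?^\ell:\,?\Rightarrow H$; $(c;d):A\Rightarrow C$ for $c:A\Rightarrow B$, $d:B\Rightarrow C$; $c\to d:(A\to B)\Rightarrow(C\to D)$ for $c:C\Rightarrow A$, $d:B\Rightarrow D$; $c\times d:(A\times B)\Rightarrow(C\times D)$ and $c+d:(A+B)\Rightarrow(C+D)$ for $c:A\Rightarrow C$, $d:B\Rightarrow D$. *Inert*: $G!$ and $c\to d$. *Active*: $\mathsf{id}$, $H?^\ell$, $c;d$, $c\times d$, $c+d$. **Terms** (intrinsically typed; $M:\Gamma\vdash' A$): $\$k:P$ for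 $k\in[\![P]\!]$; $`x:A$ if $x$ has type $A$ in $\Gamma$; $\lambda M:A\to B$ if $M:\Gamma\cdot A\vdash' B$; $L\,M:B$ if $L:A\to B$, $M:A$; $\mathtt{if}\,L\,M\,N:B$ if $L:\mathtt{Bool}$, $M,N:B$; $\mathtt{cons}\,M\,N:A\times B$; $\pi_iM:A_i$ if $M:A_1\times A_2$; $\mathtt{inl}[B]M:A+B$ if $M:A$; $\mathtt{inr}[A]M:A+B$ if $M:B$; $\mathtt{case}\,L\,M\,N:B$ if $L:\Gamma\vdash' A_1+A_2$, $M:\Gamma\cdot A_1\vdash' B$, $N:\Gamma\cdot A_2\vdash' B$; $M\langle c\rangle:B$ if $M:A$, $c:A\Rightarrow B$; $M\langle\!\langle c\rangle\!\rangle:B$ likewise with $c$ inert; $\mathtt{blame}\,\ell:A$ for every $A$. **Values** $V,W$: $\lambda M$; $\$k$; $\mathtt{cons}\,V\,W$; $\mathtt{inl}[B]V$; $\mathtt{inr}[A]V$; $V\langle\!\langle c\rangle\!\rangle$. **Frames** $F$: $\Box\,M$; $V\,\Box$; $\mathtt{if}\,\Box\,M\,N$; $\mathtt{cons}\,V\,\Box$; $\mathtt{cons}\,\Box\,N$; $\pi_i\Box$; $\mathtt{inl}[B]\Box$; $\mathtt{inr}[A]\Box$; $\mathtt{case}\,\Box\,M\,N$; $\Box\langle c\rangle$; $\Box\langle\!\langle c\rangle\!\rangle$. **Reduction** ($M[N]$ is substitution for variable $0$): - $F[M]\longrightarrow F[M']$ if $M\longrightarrow M'$; $F[\mathtt{blame}\,\ell]\longrightarrow\mathtt{blame}\,\ell$;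 $V\langle c\rangle\longrightarrow V\langle\!\langle c\rangle\!\rangle$ for $c$ inert. - $V\langle\mathsf{id}\rangle\longrightarrow V$; $V\langle\!\langle G!\rangle\!\rangle\langle H?^\ell\rangle\longrightarrow V$ if $G=H$, and $\longrightarrow\mathtt{blame}\,\ell$ otherwise; $V\langle c;d\rangle\longrightarrow V\langle c\rangle\langle d\rangle$. - $V\langle c\times d\rangle\longrightarrow\mathtt{cons}\,((\pi_1V)\langle c\rangle)\,((\pi_2V)\langle d\rangle)$; $V\langle c+d\rangle\longrightarrow\mathtt{case}\,V\,(\mathtt{inl}[D](`0\langle c\rangle))\,(\mathtt{inr}[C](`0\langle d\rangle))$ where the target of $c+d$ is $C+D$. - $V\langle\!\langle c\to d\rangle\!\rangle\,W\longrightarrow(V\,(W\langle c\rangle))\langle d\rangle$. - $(\lambda M)V\longrightarrow M[V]$; $\mathtt{if}\,\$\mathtt{true}\,M\,N\longrightarrow M$; $\mathtt{if}\,\$\mathtt{false}\,M\,N\longrightarrow N$; $\pi_1(\mathtt{cons}\,V\,W)\longrightarrow V$; $\pi_2(\mathtt{cons}\,V\,W)\longrightarrow W$; $\mathtt{case}(\mathtt{inl}[B]V)\,M\,N\longrightarrow M[V]$; $\mathtt{case}(\mathtt{inr}[A]V)\,M\,N\longrightarrow N[V]$; $\$k\,\$k'\longrightarrow\$(k(k'))$. $\longrightarrow^{*}$ is the reflexive-transitive closure. **Blame safety.** $\mathsf{CastBlameSafe}\,c\,\ell$ holds iff every projection $H?^{\ell'}$ occurring in $c$ has $\ell'\neq\ell$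 (inductively: it holds for $\mathsf{id}$ and $G!$; for $H?^{\ell'}$ iff $\ell'\neq\ell$; for $c;d$, $c\to d$, $c\times d$, $c+d$ iff it holds for $c$ and $d$). $M$ is *safe for* $\ell$ iff every cast $c$ occurring in $M$ (in a subterm $N\langle c\rangle$ or $N\langle\!\langle c\rangle\!\rangle$) satisfies $\mathsf{CastBlameSafe}\,c\,\ell$ and every subterm $\mathtt{blame}\,\ell'$ of $M$ has $\ell'\neq\ell$. *)

theory Defs
  imports Main "HOL-Library.FuncSet"
begin

section \<open>Types and constants\<close>

datatype base = NatB | BoolB | IntB | UnitB | BotB

datatype ty =
    Base base
  | Dyn  (\<open>\<star>\<close>)
  | Fun ty ty  (infixr \<open>\<rightarrow>\<^sub>T\<close> 65)
  | Prod ty ty  (infixr \<open>\<times>\<^sub>T\<close> 70)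
  | Sum ty ty  (infixr \<open>+\<^sub>T\<close> 68)

definition atomic :: "ty \<Rightarrow> bool" where
  "atomic A \<longleftrightarrow> A = \<star> \<or> (\<exists>b. A = Base b)"

definition ground :: "ty \<Rightarrow> bool" where
  "ground A \<longleftrightarrow> A \<in> range Base \<union> {\<star> \<rightarrow>\<^sub>T \<star>, \<star> \<times>\<^sub>T \<star>, \<star> +\<^sub>T \<star>}"

datatype prim = PBase base | PFun base prim

primrec ty_of_prim :: "prim \<Rightarrow> ty" where
  "ty_of_prim (PBase b) = Base b"
| "ty_of_prim (PFun b P) = Base b \<rightarrow>\<^sub>T ty_of_prim P"

text \<open>
  All sets denoted by primitive types are carved out of the single type \<open>const\<close>. A function
  with domain \<open>\<lbrakk>b\<rbrakk>\<close> is represented by its extensional total extension (value \<open>undefined\<close>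
  outside \<open>\<lbrakk>b\<rbrakk>\<close>), so that \<open>\<lbrakk>b \<rightarrow> P\<rbrakk>\<close> is in bijection with the functions from
  \<open>\<lbrakk>b\<rbrakk>\<close> to \<open>\<lbrakk>P\<rbrakk>\<close>; in particular it is a singleton for \<open>b = \<bottom>\<close>.
\<close>

datatype base_val = NatV nat | BoolV bool | IntV int | UnitV

datatype const = BaseC base_val | FunC "base_val \<Rightarrow> const"

primrec base_den :: "base \<Rightarrow> base_val set" where
  "base_den NatB = range NatV"
| "base_den BoolB = range BoolV"
| "base_den IntB = range IntV"
| "base_den UnitB = {UnitV}"
| "base_den BotB = {}"

primrec prim_den :: "prim \<Rightarrow> const set" where
  "prim_den (PBase b) = BaseC ` base_den b"
| "prim_den (PFun b P) = FunC ` (base_den b \<rightarrow>\<^sub>E prim_den P)"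


section \<open>Coercions\<close>

datatype 'l coercion =
    IdC ty
  | Inj ty
  | Proj ty 'l
  | SeqC "'l coercion" "'l coercion"
  | FunCo "'l coercion" "'l coercion"
  | ProdCo "'l coercion" "'l coercion"
  | SumCo "'l coercion" "'l coercion"

inductive coercion_ty :: "'l coercion \<Rightarrow> ty \<Rightarrow> ty \<Rightarrow> bool"
  (\<open>_ : _ \<Rightarrow>\<^sub>c _\<close> [51, 51, 51] 50) where
  "atomic a \<Longrightarrow> IdC a : a \<Rightarrow>\<^sub>c a"
| "ground G \<Longrightarrow> Inj G : G \<Rightarrow>\<^sub>c \<star>"
| "ground H \<Longrightarrow> Proj H \<l> : \<star> \<Rightarrow>\<^sub>c H"
| "c : A \<Rightarrow>\<^sub>c B \<Longrightarrow> d : B \<Rightarrow>\<^sub>c C \<Longrightarrow> SeqC c d : A \<Rightarrow>\<^sub>c C"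
| "c : C \<Rightarrow>\<^sub>c A \<Longrightarrow> d : B \<Rightarrow>\<^sub>c D \<Longrightarrow> FunCo c d : (A \<rightarrow>\<^sub>T B) \<Rightarrow>\<^sub>c (C \<rightarrow>\<^sub>T D)"
| "c : A \<Rightarrow>\<^sub>c C \<Longrightarrow> d : B \<Rightarrow>\<^sub>c D \<Longrightarrow> ProdCo c d : (A \<times>\<^sub>T B) \<Rightarrow>\<^sub>c (C \<times>\<^sub>T D)"
| "c : A \<Rightarrow>\<^sub>c C \<Longrightarrow> d : B \<Rightarrow>\<^sub>c D \<Longrightarrow> SumCo c d : (A +\<^sub>T B) \<Rightarrow>\<^sub>c (C +\<^sub>T D)"

primrec inert :: "'l coercion \<Rightarrow> bool" where
  "inert (IdC a) = False"
| "inert (Inj G) = True"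
| "inert (Proj H \<l>) = False"
| "inert (SeqC c d) = False"
| "inert (FunCo c d) = True"
| "inert (ProdCo c d) = False"
| "inert (SumCo c d) = False"


section \<open>Terms\<close>

text \<open>
  \<open>InL B M\<close> and \<open>InR A M\<close> carry the type of the other summand. \<open>Cast M c\<close> is
  \<open>M\<langle>c\<rangle>\<close>, and \<open>Wrap M c\<close> is the inert cast \<open>M\<llangle>c\<rrangle>\<close>. The bodies of \<open>Lam\<close> and both
  branches of \<open>Case\<close> bind de Bruijn index 0.
\<close>

datatype 'l trm =
    Const const
  | Var nat
  | Lam "'l trm"
  | App "'l trm" "'l trm"
  | Ite "'l trm" "'l trm" "'l trm"
  | Pair "'l trm" "'l trm"
  | Fst "'l trm"
  | Snd "'l trm"
  | InL ty "'l trm"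
  | InR ty "'l trm"
  | Case "'l trm" "'l trm" "'l trm"
  | Cast "'l trm" "'l coercion"
  | Wrap "'l trm" "'l coercion"
  | Blame 'l

text \<open>The head of a context is its last-added type.\<close>

inductive typing :: "ty list \<Rightarrow> 'l trm \<Rightarrow> ty \<Rightarrow> bool"
  (\<open>_ \<turnstile> _ : _\<close> [51, 51, 51] 50) where
  "k \<in> prim_den P \<Longrightarrow> \<Gamma> \<turnstile> Const k : ty_of_prim P"
| "x < length \<Gamma> \<Longrightarrow> \<Gamma> \<turnstile> Var x : \<Gamma> ! x"
| "A # \<Gamma> \<turnstile> M : B \<Longrightarrow> \<Gamma> \<turnstile> Lam M : A \<rightarrow>\<^sub>T B"
| "\<Gamma> \<turnstile> L : A \<rightarrow>\<^sub>T B \<Longrightarrow> \<Gamma> \<turnstile> M : A \<Longrightarrow> \<Gamma> \<turnstile> App L M : B"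
| "\<Gamma> \<turnstile> L : Base BoolB \<Longrightarrow> \<Gamma> \<turnstile> M : B \<Longrightarrow> \<Gamma> \<turnstile> N : B \<Longrightarrow> \<Gamma> \<turnstile> Ite L M N : B"
| "\<Gamma> \<turnstile> M : A \<Longrightarrow> \<Gamma> \<turnstile> N : B \<Longrightarrow> \<Gamma> \<turnstile> Pair M N : A \<times>\<^sub>T B"
| "\<Gamma> \<turnstile> M : A \<times>\<^sub>T B \<Longrightarrow> \<Gamma> \<turnstile> Fst M : A"
| "\<Gamma> \<turnstile> M : A \<times>\<^sub>T B \<Longrightarrow> \<Gamma> \<turnstile> Snd M : B"
| "\<Gamma> \<turnstile> M : A \<Longrightarrow> \<Gamma> \<turnstile> InL B M : A +\<^sub>T B"
| "\<Gamma> \<turnstile> M : B \<Longrightarrow> \<Gamma> \<turnstile> InR A M : A +\<^sub>T B"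
| "\<Gamma> \<turnstile> L : A\<^sub>1 +\<^sub>T A\<^sub>2 \<Longrightarrow> A\<^sub>1 # \<Gamma> \<turnstile> M : B \<Longrightarrow> A\<^sub>2 # \<Gamma> \<turnstile> N : B \<Longrightarrow> \<Gamma> \<turnstile> Case L M N : B"
| "\<Gamma> \<turnstile> M : A \<Longrightarrow> c : A \<Rightarrow>\<^sub>c B \<Longrightarrow> \<Gamma> \<turnstile> Cast M c : B"
| "\<Gamma> \<turnstile> M : A \<Longrightarrow> c : A \<Rightarrow>\<^sub>c B \<Longrightarrow> inert c \<Longrightarrow> \<Gamma> \<turnstile> Wrap M c : B"
| "\<Gamma> \<turnstile> Blame \<l> : A"


section \<open>Substitution\<close>

text \<open>\<open>case_nat a f\<close> is the sequence with head \<open>a\<close> followed by \<open>f\<close>.\<close>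

primrec rename :: "(nat \<Rightarrow> nat) \<Rightarrow> 'l trm \<Rightarrow> 'l trm" where
  "rename \<rho> (Const k) = Const k"
| "rename \<rho> (Var x) = Var (\<rho> x)"
| "rename \<rho> (Lam M) = Lam (rename (case_nat 0 (Suc \<circ> \<rho>)) M)"
| "rename \<rho> (App L M) = App (rename \<rho> L) (rename \<rho> M)"
| "rename \<rho> (Ite L M N) = Ite (rename \<rho> L) (rename \<rho> M) (rename \<rho> N)"
| "rename \<rho> (Pair M N) = Pair (rename \<rho> M) (rename \<rho> N)"
| "rename \<rho> (Fst M) = Fst (rename \<rho> M)"
| "rename \<rho> (Snd M) = Snd (rename \<rho> M)"
| "rename \<rho> (InL B M) = InL B (rename \<rho> M)"
| "rename \<rho> (InR A M) = InR A (rename \<rho> M)"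
| "rename \<rho> (Case L M N) = Case (rename \<rho> L)
     (rename (case_nat 0 (Suc \<circ> \<rho>)) M) (rename (case_nat 0 (Suc \<circ> \<rho>)) N)"
| "rename \<rho> (Cast M c) = Cast (rename \<rho> M) c"
| "rename \<rho> (Wrap M c) = Wrap (rename \<rho> M) c"
| "rename \<rho> (Blame \<l>) = Blame \<l>"

definition lift :: "(nat \<Rightarrow> 'l trm) \<Rightarrow> nat \<Rightarrow> 'l trm" where
  "lift \<sigma> = case_nat (Var 0) (rename Suc \<circ> \<sigma>)"

primrec subst :: "(nat \<Rightarrow> 'l trm) \<Rightarrow> 'l trm \<Rightarrow> 'l trm" where
  "subst \<sigma> (Const k) = Const k"
| "subst \<sigma> (Var x) = \<sigma> x"
| "subst \<sigma> (Lam M) = Lam (subst (lift \<sigma>) M)"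
| "subst \<sigma> (App L M) = App (subst \<sigma> L) (subst \<sigma> M)"
| "subst \<sigma> (Ite L M N) = Ite (subst \<sigma> L) (subst \<sigma> M) (subst \<sigma> N)"
| "subst \<sigma> (Pair M N) = Pair (subst \<sigma> M) (subst \<sigma> N)"
| "subst \<sigma> (Fst M) = Fst (subst \<sigma> M)"
| "subst \<sigma> (Snd M) = Snd (subst \<sigma> M)"
| "subst \<sigma> (InL B M) = InL B (subst \<sigma> M)"
| "subst \<sigma> (InR A M) = InR A (subst \<sigma> M)"
| "subst \<sigma> (Case L M N) = Case (subst \<sigma> L) (subst (lift \<sigma>) M) (subst (lift \<sigma>) N)"
| "subst \<sigma> (Cast M c) = Cast (subst \<sigma> M) c"
| "subst \<sigma> (Wrap M c) = Wrap (subst \<sigma> M) c"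
| "subst \<sigma> (Blame \<l>) = Blame \<l>"

definition subst0 :: "'l trm \<Rightarrow> 'l trm \<Rightarrow> 'l trm" (\<open>_[[_]]\<close> [1000, 0] 1000) where
  "M[[N]] = subst (case_nat N Var) M"


section \<open>Values, frames, and reduction\<close>

inductive val :: "'l trm \<Rightarrow> bool" where
  "val (Lam M)"
| "val (Const k)"
| "val V \<Longrightarrow> val W \<Longrightarrow> val (Pair V W)"
| "val V \<Longrightarrow> val (InL B V)"
| "val V \<Longrightarrow> val (InR A V)"
| "val V \<Longrightarrow> inert c \<Longrightarrow> val (Wrap V c)"

datatype 'l frame =
    AppL "'l trm"
  | AppR "'l trm"
  | IteF "'l trm" "'l trm"
  | PairR "'l trm"
  | PairL "'l trm"
  | FstF
  | SndF
  | InLF ty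
  | InRF ty
  | CaseF "'l trm" "'l trm"
  | CastF "'l coercion"
  | WrapF "'l coercion"

primrec plug :: "'l frame \<Rightarrow> 'l trm \<Rightarrow> 'l trm" where
  "plug (AppL M) X = App X M"
| "plug (AppR V) X = App V X"
| "plug (IteF M N) X = Ite X M N"
| "plug (PairR V) X = Pair V X"
| "plug (PairL N) X = Pair X N"
| "plug FstF X = Fst X"
| "plug SndF X = Snd X"
| "plug (InLF B) X = InL B X"
| "plug (InRF A) X = InR A X"
| "plug (CaseF M N) X = Case X M N"
| "plug (CastF c) X = Cast X c"
| "plug (WrapF c) X = Wrap X c"

inductive valid_frame :: "'l frame \<Rightarrow> bool" where
  "valid_frame (AppL M)"
| "val V \<Longrightarrow> valid_frame (AppR V)"
| "valid_frame (IteF M N)"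
| "val V \<Longrightarrow> valid_frame (PairR V)"
| "valid_frame (PairL N)"
| "valid_frame FstF"
| "valid_frame SndF"
| "valid_frame (InLF B)"
| "valid_frame (InRF A)"
| "valid_frame (CaseF M N)"
| "valid_frame (CastF c)"
| "inert c \<Longrightarrow> valid_frame (WrapF c)"

text \<open>
  Reduction is defined on untyped syntax. In the rule for \<open>SumCo\<close> the coercion typings only
  serve to name the target \<open>C + D\<close> of the coercion, which it determines.
\<close>

inductive red :: "'l trm \<Rightarrow> 'l trm \<Rightarrow> bool" (infix \<open>\<longrightarrow>\<^sub>r\<close> 50) where
  "valid_frame F \<Longrightarrow> M \<longrightarrow>\<^sub>r M' \<Longrightarrow> plug F M \<longrightarrow>\<^sub>r plug F M'"
| "valid_frame F \<Longrightarrow> plug F (Blame \<l>) \<longrightarrow>\<^sub>r Blame \<l>"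
| "val V \<Longrightarrow> inert c \<Longrightarrow> Cast V c \<longrightarrow>\<^sub>r Wrap V c"
| "val V \<Longrightarrow> Cast V (IdC a) \<longrightarrow>\<^sub>r V"
| "val V \<Longrightarrow> G = H \<Longrightarrow> Cast (Wrap V (Inj G)) (Proj H \<l>) \<longrightarrow>\<^sub>r V"
| "val V \<Longrightarrow> G \<noteq> H \<Longrightarrow> Cast (Wrap V (Inj G)) (Proj H \<l>) \<longrightarrow>\<^sub>r Blame \<l>"
| "val V \<Longrightarrow> Cast V (SeqC c d) \<longrightarrow>\<^sub>r Cast (Cast V c) d"
| "val V \<Longrightarrow> Cast V (ProdCo c d) \<longrightarrow>\<^sub>r Pair (Cast (Fst V) c) (Cast (Snd V) d)"
| "val V \<Longrightarrow> c : A \<Rightarrow>\<^sub>c C \<Longrightarrow> d : B \<Rightarrow>\<^sub>c D \<Longrightarrow>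
     Cast V (SumCo c d) \<longrightarrow>\<^sub>r Case V (InL D (Cast (Var 0) c)) (InR C (Cast (Var 0) d))"
| "val V \<Longrightarrow> val W \<Longrightarrow> App (Wrap V (FunCo c d)) W \<longrightarrow>\<^sub>r Cast (App V (Cast W c)) d"
| "val V \<Longrightarrow> App (Lam M) V \<longrightarrow>\<^sub>r M[[V]]"
| "Ite (Const (BaseC (BoolV True))) M N \<longrightarrow>\<^sub>r M"
| "Ite (Const (BaseC (BoolV False))) M N \<longrightarrow>\<^sub>r N"
| "val V \<Longrightarrow> val W \<Longrightarrow> Fst (Pair V W) \<longrightarrow>\<^sub>r V"
| "val V \<Longrightarrow> val W \<Longrightarrow> Snd (Pair V W) \<longrightarrow>\<^sub>r W"
| "val V \<Longrightarrow> Case (InL B V) M N \<longrightarrow>\<^sub>r M[[V]]"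
| "val V \<Longrightarrow> Case (InR A V) M N \<longrightarrow>\<^sub>r N[[V]]"
| "App (Const (FunC f)) (Const (BaseC v)) \<longrightarrow>\<^sub>r Const (f v)"

abbreviation reds :: "'l trm \<Rightarrow> 'l trm \<Rightarrow> bool" (infix \<open>\<longrightarrow>\<^sub>r\<^sup>*\<close> 50) where
  "M \<longrightarrow>\<^sub>r\<^sup>* N \<equiv> red\<^sup>*\<^sup>* M N"


section \<open>Blame safety\<close>

primrec cast_blame_safe :: "'l coercion \<Rightarrow> 'l \<Rightarrow> bool" where
  "cast_blame_safe (IdC a) \<l> \<longleftrightarrow> True"
| "cast_blame_safe (Inj G) \<l> \<longleftrightarrow> True"
| "cast_blame_safe (Proj H \<l>') \<l> \<longleftrightarrow> \<l>' \<noteq> \<l>"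
| "cast_blame_safe (SeqC c d) \<l> \<longleftrightarrow> cast_blame_safe c \<l> \<and> cast_blame_safe d \<l>"
| "cast_blame_safe (FunCo c d) \<l> \<longleftrightarrow> cast_blame_safe c \<l> \<and> cast_blame_safe d \<l>"
| "cast_blame_safe (ProdCo c d) \<l> \<longleftrightarrow> cast_blame_safe c \<l> \<and> cast_blame_safe d \<l>"
| "cast_blame_safe (SumCo c d) \<l> \<longleftrightarrow> cast_blame_safe c \<l> \<and> cast_blame_safe d \<l>"

primrec subterms :: "'l trm \<Rightarrow> 'l trm set" where
  "subterms (Const k) = {Const k}"
| "subterms (Var x) = {Var x}"
| "subterms (Lam M) = insert (Lam M) (subterms M)"
| "subterms (App L M) = insert (App L M) (subterms L \<union> subterms M)"
| "subterms (Ite L M N) = insert (Ite L M N) (subterms L \<union> subterms M \<union> subterms N)"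
| "subterms (Pair M N) = insert (Pair M N) (subterms M \<union> subterms N)"
| "subterms (Fst M) = insert (Fst M) (subterms M)"
| "subterms (Snd M) = insert (Snd M) (subterms M)"
| "subterms (InL B M) = insert (InL B M) (subterms M)"
| "subterms (InR A M) = insert (InR A M) (subterms M)"
| "subterms (Case L M N) = insert (Case L M N) (subterms L \<union> subterms M \<union> subterms N)"
| "subterms (Cast M c) = insert (Cast M c) (subterms M)"
| "subterms (Wrap M c) = insert (Wrap M c) (subterms M)"
| "subterms (Blame \<l>) = {Blame \<l>}"

definition safe_for :: "'l trm \<Rightarrow> 'l \<Rightarrow> bool" where
  "safe_for M \<l> \<longleftrightarrow>
     (\<forall>N c. Cast N c \<in> subterms M \<or> Wrap N c \<in> subterms M \<longrightarrow> cast_blame_safe c \<l>) \<and>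
     (\<forall>\<l>'. Blame \<l>' \<in> subterms M \<longrightarrow> \<l>' \<noteq> \<l>)"

end

theory Submission
  imports Defs
begin

text \<open>Safety for \<open>\<l>\<close> is an invariant of reduction, and
  \<open>Blame \<l>\<close> violates it. A new blame term arises only from a failing projection,
  whose label differs from \<open>\<l>\<close> by safety; all other rules merely move, copy or drop
  existing subterms and labels, or split coercions into components. \<open>safe_for_red\<close>
  carries this, with \<open>safe_for_subst0\<close> for the rules that substitute.\<close>

text \<open>Recasts the quantification over subterms as a structural recursion, the form that the
  inductions use.\<close>

lemma safe_for_simps [simp]:
  "safe_for (Const k) \<l>"
  "safe_for (Var x) \<l>"
  "safe_for (Lam M) \<l> \<longleftrightarrow> safe_for M \<l>"
  "safe_for (App L M) \<l> \<longleftrightarrow> safe_for L \<l> \<and> safe_for M \<l>"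
  "safe_for (Ite L M N) \<l> \<longleftrightarrow> safe_for L \<l> \<and> safe_for M \<l> \<and> safe_for N \<l>"
  "safe_for (Pair M N) \<l> \<longleftrightarrow> safe_for M \<l> \<and> safe_for N \<l>"
  "safe_for (Fst M) \<l> \<longleftrightarrow> safe_for M \<l>"
  "safe_for (Snd M) \<l> \<longleftrightarrow> safe_for M \<l>"
  "safe_for (InL B M) \<l> \<longleftrightarrow> safe_for M \<l>"
  "safe_for (InR A M) \<l> \<longleftrightarrow> safe_for M \<l>"
  "safe_for (Case L M N) \<l> \<longleftrightarrow> safe_for L \<l> \<and> safe_for M \<l> \<and> safe_for N \<l>"
  "safe_for (Cast M c) \<l> \<longleftrightarrow> safe_for M \<l> \<and> cast_blame_safe c \<l>"
  "safe_for (Wrap M c) \<l> \<longleftrightarrow> safe_for M \<l> \<and> cast_blame_safe c \<l>"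
  "safe_for (Blame \<l>') \<l> \<longleftrightarrow> \<l>' \<noteq> \<l>"
  unfolding safe_for_def by auto

lemma safe_for_rename [simp]: "safe_for (rename \<rho> M) \<l> \<longleftrightarrow> safe_for M \<l>"
  by (induction M arbitrary: \<rho>) auto

lemma safe_for_lift:
  assumes "\<And>x. safe_for (\<sigma> x) \<l>"
  shows "safe_for (lift \<sigma> x) \<l>"
  using assms by (simp add: lift_def split: nat.split)

text \<open>Safety of \<sigma> at every index is preserved by \<open>lift\<close>, so the induction,
  general in \<sigma>, passes under binders.\<close>

lemma safe_for_subst:
  assumes "safe_for M \<l>" and "\<And>x. safe_for (\<sigma> x) \<l>"
  shows "safe_for (subst \<sigma> M) \<l>"
  using assms by (induction M arbitrary: \<sigma>) (simp_all add: safe_for_lift)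

lemma safe_for_subst0:
  assumes "safe_for M \<l>" and "safe_for N \<l>"
  shows "safe_for (M[[N]]) \<l>"
  using assms unfolding subst0_def by (auto intro!: safe_for_subst split: nat.split)

lemma safe_for_plugD: "safe_for (plug F M) \<l> \<Longrightarrow> safe_for M \<l>"
  by (cases F) auto

text \<open>Safety of a plugged frame splits into that of the frame and that of the filler; this
  serves the congruence rule, as \<open>safe_for_plugD\<close> also serves blame
  propagation.\<close>

lemma safe_for_plug_replace:
  "safe_for (plug F M) \<l> \<Longrightarrow> safe_for M' \<l> \<Longrightarrow> safe_for (plug F M') \<l>"
  by (cases F) auto

lemma safe_for_red:
  assumes "M \<longrightarrow>\<^sub>r M'" and "safe_for M \<l>"
  shows "safe_for M' \<l>"
  using assms
  by induction (auto intro: safe_for_subst0 safe_for_plug_replace dest: safe_for_plugD)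

lemma safe_for_reds:
  assumes "M \<longrightarrow>\<^sub>r\<^sup>* M'" and "safe_for M \<l>"
  shows "safe_for M' \<l>"
  using assms by induction (auto intro: safe_for_red)

theorem corollary110:
  fixes \<Gamma> :: "ty list" and M :: "'l trm" and A :: ty and \<l> :: 'l
  assumes "\<Gamma> \<turnstile> M : A"
    and "safe_for M \<l>"
  shows "\<not> M \<longrightarrow>\<^sub>r\<^sup>* Blame \<l>"
proof
  assume "M \<longrightarrow>\<^sub>r\<^sup>* Blame \<l>"
  then have "safe_for (Blame \<l>) \<l>"
    using assms(2) by (rule safe_for_reds)
  then show False
    by simp
qed

end
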